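(* Let $X, Y \in su_2$, let $S = \{X, Y\}$ and let $\overline{S} = \{\tau X + (1-\tau) Y \mid \tau \in [0,1]\}$. Then the time-optimization problem in $SU_2$ with the set of controls $S$ is equivalent to the one with the set of controls $\overline{S}$; that is, for every $g \in SU_2$, $$T_S(g) = T_{\overline{S}}(g).$$
   Context: For a set of controls $C \subset su_2$ (the Lie algebra of $SU_2$) and $g \in SU_2$, define $$T_C(g) = \inf\{\, t_1 + \ldots + t_n \mid n \ge 0,\ g = \exp(t_1 C_1)\cdots\exp(t_n C_n),\ t_i \ge 0,\ C_i \in C \,\},$$ the infimum of total time over all decompositions of $g$ into finite products (of arbitrary length $n$; the empty product is the identity) of exponentials of controls with nonnegative times. The infimum of the empty set is $+\infty$. *)

theory Defs
  imports "HOL-Analysis.Analysis"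
begin

definition conj_transpose :: "complex^'n^'m \<Rightarrow> complex^'m^'n" where
  "conj_transpose A = map_matrix cnj (transpose A)"

definition su2 :: "(complex^2^2) set" where
  "su2 = {A. conj_transpose A = - A \<and> trace A = 0}"

definition SU2 :: "(complex^2^2) set" where
  "SU2 = {g. conj_transpose g ** g = mat 1 \<and> det g = 1}"

(* The library function exp and the library power operator do not apply here: the ring
   product on the type vec is componentwise, whereas ** is the matrix product. *)
definition matrix_power :: "complex^'n^'n \<Rightarrow> nat \<Rightarrow> complex^'n^'n" where
  "matrix_power A k = (((**) A) ^^ k) (mat 1)"

definition matrix_exp :: "complex^'n^'n \<Rightarrow> complex^'n^'n" where
  "matrix_exp A = (\<Sum>k. (1 / fact k) *\<^sub>R matrix_power A k)"

(* A list [(t1, C1), ..., (tn, Cn)] of timed controls stands for the ordered product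
   exp (t1 C1) ** ... ** exp (tn Cn); the empty list gives the identity. *)
definition control_product :: "(real \<times> (complex^'n^'n)) list \<Rightarrow> complex^'n^'n" where
  "control_product cs = foldr (\<lambda>(t, A) P. matrix_exp (t *\<^sub>R A) ** P) cs (mat 1)"

(* Values in ereal, so that Inf {} = \<infinity>. *)
definition optimal_time :: "(complex^'n^'n) set \<Rightarrow> complex^'n^'n \<Rightarrow> ereal" where
  "optimal_time C g =
     Inf {ereal (sum_list (map fst cs)) | cs.
            (\<forall>(t, A) \<in> set cs. 0 \<le> t \<and> A \<in> C) \<and> g = control_product cs}"

end

theory Submission
  imports Defs
begin

text \<open>
  Let $C = \tau X + (1 - \tau) Y$. Palindromic products of exponentials of $X$ and $Y$ stay in
  the span of $1, X, Y$ (as quaternions), so the exponential of $h C$ for small $h > 0$ can be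
  written exactly as $\exp(aX) \exp(bY) \exp(aX)$: in $\exp(-aX) \exp(hC) \exp(-aX)$ the
  coefficient of $X$ vanishes for a suitable $a$ by the intermediate value theorem, the coefficient
  of $Y$ does not depend on $a$, and determinants fix the scalar part up to sign. The
  total time $2a + b$ is $h + o(h)$, so splitting a segment of duration $t$ into many equal pieces
  and replacing each of them costs arbitrarily little extra time.
\<close>

section \<open>Quaternion relations in \<open>su2\<close>\<close>

lemma scaleR_matrix_mult:
  fixes A B :: "complex^'n^'n"
  shows "(c *\<^sub>R A) ** B = c *\<^sub>R (A ** B)" "A ** (c *\<^sub>R B) = c *\<^sub>R (A ** B)"
  by (simp_all add: matrix_matrix_mult_def vec_eq_iff scaleR_sum_right)

lemma matrix_add_rdistrib:
  fixes A B C :: "complex^'n^'n"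
  shows "(A + B) ** C = A ** C + B ** C"
  by (simp add: matrix_matrix_mult_def vec_eq_iff sum.distrib distrib_right)

lemma su2_entries:
  assumes "A \<in> su2"
  shows "Re (A $ 1 $ 1) = 0" "A $ 2 $ 2 = - (A $ 1 $ 1)" "A $ 2 $ 1 = - cnj (A $ 1 $ 2)"
proof -
  have 1: "cnj (A $ j $ i) = - (A $ i $ j)" for i j
    using assms by (simp add: su2_def conj_transpose_def vec_eq_iff map_matrix_def transpose_def)
  show "Re (A $ 1 $ 1) = 0" using 1[of 1 1] by (auto simp: complex_eq_iff)
  show "A $ 2 $ 2 = - (A $ 1 $ 1)" using assms by (simp add: su2_def trace_def sum_2 add_eq_0_iff)
  show "A $ 2 $ 1 = - cnj (A $ 1 $ 2)" using 1[of 1 2] by simp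
qed

text \<open>The determinant is the squared length of \<open>A\<close> as an imaginary quaternion;
  being real, it is carried as \<open>Re (det A)\<close> from here on.\<close>

lemma su2_det:
  assumes "A \<in> su2"
  shows "det A = of_real ((Im (A $ 1 $ 1))\<^sup>2 + (Re (A $ 1 $ 2))\<^sup>2 + (Im (A $ 1 $ 2))\<^sup>2)"
  using su2_entries[OF assms] by (simp add: det_2 complex_eq_iff power2_eq_square)

text \<open>Cayley-Hamilton with zero trace.\<close>

lemma su2_square:
  assumes "A \<in> su2"
  shows "A ** A = - (Re (det A)) *\<^sub>R mat 1"
  unfolding su2_det[OF assms] using su2_entries[OF assms]
  by (simp add: matrix_matrix_mult_def vec_eq_iff forall_2 sum_2 mat_def complex_eq_iff
      power2_eq_square algebra_simps)

lemma su2_det_pos: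
  assumes "A \<in> su2" "A \<noteq> 0"
  shows "0 < Re (det A)"
proof -
  have "Im (A $ 1 $ 1) \<noteq> 0 \<or> Re (A $ 1 $ 2) \<noteq> 0 \<or> Im (A $ 1 $ 2) \<noteq> 0"
    using assms(2) su2_entries[OF assms(1)] by (auto simp: vec_eq_iff forall_2 complex_eq_iff)
  then show ?thesis
    by (elim disjE) (simp_all add: su2_det[OF assms(1)] add_pos_nonneg add_nonneg_pos)
qed

lemma su2_combination:
  assumes "A \<in> su2" "B \<in> su2"
  shows "a *\<^sub>R A + b *\<^sub>R B \<in> su2"
  using assms
  by (auto simp: su2_def conj_transpose_def vec_eq_iff map_matrix_def transpose_def trace_def
      sum_2 algebra_simps simp flip: scaleR_right_distrib)

text \<open>Polarization of \<open>su2_square\<close> at \<open>A + B\<close>; \<open>m\<close> is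
  the inner product of the two imaginary quaternions.\<close>

lemma su2_anticommutator:
  assumes "A \<in> su2" "B \<in> su2"
  obtains m :: real where "B ** A = (- 2 * m) *\<^sub>R mat 1 - A ** B"
proof -
  have "A + B \<in> su2" using su2_combination[OF assms, of 1 1] by simp
  from su2_square[OF this] su2_square[OF assms(1)] su2_square[OF assms(2)]
  have "B ** A = (Re (det A) + Re (det B) - Re (det (A + B))) *\<^sub>R mat 1 - A ** B"
    by (simp add: matrix_add_ldistrib matrix_add_rdistrib algebra_simps)
  moreover have "Re (det A) + Re (det B) - Re (det (A + B)) =
      - 2 * ((Re (det (A + B)) - Re (det A) - Re (det B)) / 2)"
    by (simp add: field_simps)
  ultimately show ?thesis by (metis that)
qed

section \<open>Closed form of the exponential on \<open>su2\<close>\<close>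

lemma matrix_power_scaleR: "matrix_power (t *\<^sub>R A) k = t ^ k *\<^sub>R matrix_power A k"
  by (induction k) (simp_all add: matrix_power_def scaleR_matrix_mult)

text \<open>\<open>A\<close> behaves like \<open>x\<close> times an imaginary unit, so its powers
  alternate between the lines through \<open>mat 1\<close> and \<open>A\<close>. The subtraction
  \<open>k - 1\<close> occurs only for odd \<open>k\<close> and never truncates.\<close>

lemma matrix_power_square_neg:
  assumes "A ** A = - (x\<^sup>2) *\<^sub>R mat 1"
  shows "matrix_power A k = (if even k then ((-1) ^ (k div 2) * x ^ k) *\<^sub>R mat 1
     else ((-1) ^ ((k - 1) div 2) * x ^ (k - 1)) *\<^sub>R A)"
proof (induction k)
  case 0 then show ?case by (simp add: matrix_power_def)
next
  case (Suc k)
  have "matrix_power A (Suc k) = A ** matrix_power A k" by (simp add: matrix_power_def)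
  then show ?case using assms
    by (cases "even k") (auto simp: Suc scaleR_matrix_mult power2_eq_square elim!: oddE)
qed

text \<open>Treats the zero matrix, which the Euler formula below excludes because it divides by
  \<open>x\<close>.\<close>

lemma matrix_exp_0: "matrix_exp (0 :: complex^'n^'n) = mat 1"
proof -
  have "(1 / fact k) *\<^sub>R matrix_power (0::complex^'n^'n) k = (if k = 0 then mat 1 else 0)" for k
    by (cases k) (simp_all add: matrix_power_def)
  then show ?thesis
    unfolding matrix_exp_def using sums_single[of 0 "\<lambda>_. mat 1 :: complex^'n^'n"]
    by (simp add: sums_iff cong: if_cong)
qed

text \<open>Euler's formula: the even terms sum to the cosine series and the odd ones to the sine
  series.\<close>

lemma matrix_exp_square_neg:
  assumes "A ** A = - (x\<^sup>2) *\<^sub>R mat 1" "x \<noteq> 0"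
  shows "matrix_exp (t *\<^sub>R A) = cos (t * x) *\<^sub>R mat 1 + (sin (t * x) / x) *\<^sub>R A"
proof -
  have "(1 / fact k) *\<^sub>R matrix_power (t *\<^sub>R A) k =
     (cos_coeff k *\<^sub>R (t * x) ^ k) *\<^sub>R mat 1 + ((sin_coeff k *\<^sub>R (t * x) ^ k) / x) *\<^sub>R A" for k
    using assms(2)
    by (auto simp: matrix_power_scaleR matrix_power_square_neg[OF assms(1)] cos_coeff_def sin_coeff_def
        power_mult_distrib elim!: oddE)
  moreover have "(\<lambda>k. (cos_coeff k *\<^sub>R (t * x) ^ k) *\<^sub>R (mat 1 :: complex^'a^'a)
      + ((sin_coeff k *\<^sub>R (t * x) ^ k) / x) *\<^sub>R A)
     sums (cos (t * x) *\<^sub>R mat 1 + (sin (t * x) / x) *\<^sub>R A)"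
    by (intro sums_add sums_scaleR_left sums_divide cos_converges sin_converges)
  ultimately show ?thesis unfolding matrix_exp_def by (simp add: sums_iff)
qed

lemma su2_exp:
  assumes "A \<in> su2" "A \<noteq> 0"
  obtains x where "x > 0" "A ** A = - (x\<^sup>2) *\<^sub>R mat 1"
    "\<And>t. matrix_exp (t *\<^sub>R A) = cos (t * x) *\<^sub>R mat 1 + (sin (t * x) / x) *\<^sub>R A"
proof
  let ?x = "sqrt (Re (det A))"
  show "?x > 0" using su2_det_pos[OF assms] by simp
  show *: "A ** A = - (?x\<^sup>2) *\<^sub>R mat 1" using su2_det_pos[OF assms] su2_square[OF assms(1)] by simp
  show "matrix_exp (t *\<^sub>R A) = cos (t * ?x) *\<^sub>R mat 1 + (sin (t * ?x) / ?x) *\<^sub>R A" for t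
    using matrix_exp_square_neg[OF *, of t] \<open>?x > 0\<close> by simp
qed

text \<open>Multiplicative quaternion norm of scalar plus imaginary part; it later recovers the
  scalar part up to sign.\<close>

lemma det_scaleR_mat_1_plus:
  assumes "A \<in> su2"
  shows "det (a *\<^sub>R mat 1 + b *\<^sub>R A) = of_real (a\<^sup>2 + b\<^sup>2 * Re (det A))"
  using su2_entries[OF assms]
  by (simp add: su2_det[OF assms] det_2 mat_def complex_eq_iff power2_eq_square algebra_simps)

lemma det_su2_matrix_exp:
  assumes "A \<in> su2"
  shows "det (matrix_exp (t *\<^sub>R A)) = 1"
proof (cases "A = 0")
  case True
  then show ?thesis by (simp add: matrix_exp_0)
next
  case False
  let ?x = "sqrt (Re (det A))"
  have x: "Re (det A) > 0" using su2_det_pos[OF assms False] .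
  then have "A ** A = - (?x\<^sup>2) *\<^sub>R mat 1" using su2_square[OF assms] by simp
  from matrix_exp_square_neg[OF this] x
  have "det (matrix_exp (t *\<^sub>R A)) = of_real ((cos (t * ?x))\<^sup>2 + (sin (t * ?x) / ?x)\<^sup>2 * Re (det A))"
    by (simp add: det_scaleR_mat_1_plus[OF assms])
  also have "\<dots> = 1" using x by (simp add: power_divide flip: of_real_add of_real_power)
  finally show ?thesis .
qed

text \<open>By Euler's formula this amounts to the addition theorems for sine and cosine.\<close>

lemma su2_exp_add:
  assumes "A \<in> su2"
  shows "matrix_exp (s *\<^sub>R A) ** matrix_exp (t *\<^sub>R A) = matrix_exp ((s + t) *\<^sub>R A)"
proof (cases "A = 0")
  case True
  then show ?thesis by (simp add: matrix_exp_0)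
next
  case False
  with assms obtain x where x: "x > 0" "A ** A = - (x\<^sup>2) *\<^sub>R mat 1" 
    "\<And>t. matrix_exp (t *\<^sub>R A) = cos (t * x) *\<^sub>R mat 1 + (sin (t * x) / x) *\<^sub>R A"
    using su2_exp by blast
  have "matrix_exp (s *\<^sub>R A) ** matrix_exp (t *\<^sub>R A) = 
     (cos (s * x) * cos (t * x) - sin (s * x) * sin (t * x)) *\<^sub>R mat 1
      + (cos (s * x) * sin (t * x) / x + sin (s * x) * cos (t * x) / x) *\<^sub>R A"
    using x(1) by (simp add: x(2,3) matrix_add_ldistrib matrix_add_rdistrib scaleR_matrix_mult
        algebra_simps power2_eq_square)
  also have "\<dots> = matrix_exp ((s + t) *\<^sub>R A)"
    by (simp add: x(3) sin_add cos_add distrib_right add_divide_distrib add.commute)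
  finally show ?thesis .
qed

lemma su2_exp_power:
  assumes "A \<in> su2"
  shows "(((**) (matrix_exp (h *\<^sub>R A))) ^^ n) (mat 1) = matrix_exp ((real n * h) *\<^sub>R A)"
  by (induction n) (simp_all add: matrix_exp_0 su2_exp_add[OF assms] distrib_right)

section \<open>Choice of the angles \<open>a\<close> and \<open>b\<close> for small
  \<open>h\<close>\<close>

text \<open>
  The two sums in the conclusion that are compared with 0 are the coefficient of \<open>X\<close> and
  the scalar part in \<open>sandwich_expansion\<close> below, for \<open>w = cos (h * n)\<close>.
\<close>

lemma small_angles:
  fixes x y n m \<tau> \<delta> :: real
  assumes "x > 0" "y > 0" "n > 0" "0 \<le> \<tau>" "\<tau> \<le> 1" "\<delta> > 0"
  defines "k h \<equiv> sin (h * n) / n" and "s a \<equiv> sin (a * x) / x" and "c a \<equiv> cos (a * x)"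
  shows "\<forall>\<^sub>F h in at_right 0. \<exists>a b. 0 \<le> a \<and> 2 * a \<le> (\<tau> + \<delta>) * h \<and> 0 \<le> b \<and> b \<le> (1 - \<tau> + \<delta>) * h \<and>
     k h * \<tau> * ((c a)\<^sup>2 - x\<^sup>2 * (s a)\<^sup>2) - 2 * cos (h * n) * c a * s a - 2 * k h * (1 - \<tau>) * m * (s a)\<^sup>2 = 0 \<and>
     sin (b * y) / y = (1 - \<tau>) * k h \<and> cos (b * y) > 0 \<and>
     cos (h * n) * ((c a)\<^sup>2 - x\<^sup>2 * (s a)\<^sup>2) + 2 * k h * \<tau> * x\<^sup>2 * c a * s a + 2 * m * k h * (1 - \<tau>) * c a * s a > 0"
proof -
  define W where "W h a = cos (h * n) * ((c a)\<^sup>2 - x\<^sup>2 * (s a)\<^sup>2)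
    + 2 * k h * \<tau> * x\<^sup>2 * c a * s a + 2 * m * k h * (1 - \<tau>) * c a * s a" for h a
  define F where "F h a = k h * \<tau> * ((c a)\<^sup>2 - x\<^sup>2 * (s a)\<^sup>2)
    - 2 * cos (h * n) * c a * s a - 2 * k h * (1 - \<tau>) * m * (s a)\<^sup>2" for h a
  \<comment> \<open>Since \<open>W 0 0 = 1\<close>, joint continuity keeps the scalar part positive
    on a whole ball around the origin. Joint continuity matters because \<open>a\<close> is chosen
    only after \<open>h\<close>, with nothing but a bound known.\<close>
  have "isCont (\<lambda>z. W (fst z) (snd z)) (0, 0)"
    unfolding W_def k_def s_def c_def using assms(1-3) by (intro continuous_intros) auto
  then have "((\<lambda>z. W (fst z) (snd z)) \<longlongrightarrow> W 0 0) (nhds (0,0))"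
    by (simp add: isCont_def tendsto_nhds_iff)
  then have "\<forall>\<^sub>F z in nhds (0,0). W (fst z) (snd z) > 0"
    by (rule order_tendstoD) (simp add: W_def k_def s_def c_def)
  then obtain e where e: "e > 0" "\<And>h a. dist (h, a) (0::real, 0::real) < e \<Longrightarrow> W h a > 0"
    unfolding eventually_nhds_metric by fastforce
  have small: "\<forall>\<^sub>F h in at_right (0::real). h < d" if "d > 0" for d
    using that by (auto simp: eventually_at_right_field)
  have sin_lim: "((\<lambda>h. sin (h * z) / h) \<longlongrightarrow> z) (at_right 0)" for z :: real
  proof -
    have "((\<lambda>h. sin (h * z)) has_real_derivative z) (at 0)"
      by (auto intro!: derivative_eq_intros)
    then show ?thesis
      using filterlim_at_split[of "\<lambda>h. sin (h * z) / h" "nhds z" 0] by (simp add: has_field_derivative_iff)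
  qed
  have k0: "((\<lambda>h. k h / h) \<longlongrightarrow> 1) (at_right 0)"
    using tendsto_divide[OF sin_lim[of n] tendsto_const[of n]] \<open>n > 0\<close> by (simp add: k_def mult.commute)
  \<comment> \<open>At the largest allowed \<open>a\<close>, namely
    \<open>(\<tau> + \<delta>) / 2 * h\<close>, the coefficient of \<open>X\<close> is to first
    order \<open>(\<tau> - (\<tau> + \<delta>)) * h\<close>. The slack \<delta> makes it strictly
    negative for small \<open>h\<close>.\<close>
  have F: "((\<lambda>h. F h ((\<tau> + \<delta>) / 2 * h) / h) \<longlongrightarrow> - \<delta>) (at_right 0)"
  proof -
    let ?\<sigma> = "(\<tau> + \<delta>) / 2"
    have s0: "((\<lambda>h. s (?\<sigma> * h) / h) \<longlongrightarrow> ?\<sigma>) (at_right 0)"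
      using tendsto_divide[OF sin_lim[of "?\<sigma> * x"] tendsto_const[of x]] \<open>x > 0\<close>
      by (simp add: s_def mult_ac)
    have s: "((\<lambda>h. s (?\<sigma> * h)) \<longlongrightarrow> 0) (at_right 0)"
      unfolding s_def using \<open>x > 0\<close> by (auto intro!: tendsto_eq_intros)
    have c: "((\<lambda>h. c (?\<sigma> * h)) \<longlongrightarrow> 1) (at_right 0)"
      unfolding c_def by (auto intro!: tendsto_eq_intros)
    have n: "((\<lambda>h. cos (h * n)) \<longlongrightarrow> 1) (at_right 0)"
      by (auto intro!: tendsto_eq_intros)
    have "((\<lambda>h. k h / h * \<tau> * ((c (?\<sigma> * h))\<^sup>2 - x\<^sup>2 * (s (?\<sigma> * h))\<^sup>2)
        - 2 * cos (h * n) * c (?\<sigma> * h) * (s (?\<sigma> * h) / h)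
        - 2 * (k h / h) * (1 - \<tau>) * m * (s (?\<sigma> * h))\<^sup>2) \<longlongrightarrow>
        1 * \<tau> * (1\<^sup>2 - x\<^sup>2 * 0\<^sup>2) - 2 * 1 * 1 * ?\<sigma> - 2 * 1 * (1 - \<tau>) * m * 0\<^sup>2) (at_right 0)"
      by (intro tendsto_intros k0 s0 s c n)
    moreover have "1 * \<tau> * (1\<^sup>2 - x\<^sup>2 * 0\<^sup>2) - 2 * 1 * 1 * ?\<sigma> - 2 * 1 * (1 - \<tau>) * m * 0\<^sup>2 = - \<delta>"
      by (simp add: field_simps)
    ultimately show ?thesis by (simp add: F_def diff_divide_distrib)
  qed
  \<comment> \<open>Likewise, at the largest allowed \<open>b\<close> the value
    \<open>sin (b * y) / y\<close> exceeds its target by \<open>\<delta> * h\<close> to first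
    order.\<close>
  have G: "((\<lambda>h. (sin ((1 - \<tau> + \<delta>) * h * y) / y - (1 - \<tau>) * k h) / h) \<longlongrightarrow> \<delta>) (at_right 0)"
  proof -
    have "((\<lambda>h. sin (h * ((1 - \<tau> + \<delta>) * y)) / h / y - (1 - \<tau>) * (k h / h)) \<longlongrightarrow>
        (1 - \<tau> + \<delta>) * y / y - (1 - \<tau>) * 1) (at_right 0)"
      by (intro tendsto_intros k0 sin_lim) (use \<open>y > 0\<close> in auto)
    then show ?thesis using \<open>y > 0\<close> by (simp add: diff_divide_distrib mult_ac)
  qed
  have "\<forall>\<^sub>F h in at_right 0. F h ((\<tau> + \<delta>) / 2 * h) / h < 0" using order_tendstoD(2)[OF F] assms by simp
  moreover have "\<forall>\<^sub>F h in at_right 0. (sin ((1 - \<tau> + \<delta>) * h * y) / y - (1 - \<tau>) * k h) / h > 0"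
    using order_tendstoD(1)[OF G] assms by simp
  moreover have "\<forall>\<^sub>F h in at_right (0::real). h > 0" by (simp add: eventually_at_right_less)
  \<comment> \<open>The three thresholds ensure in turn that \<open>k h\<close> is nonnegative, that
    \<open>b * y\<close> stays below \<open>pi / 2\<close>, and that \<open>(h, a)\<close> lies in
    the ball where \<open>W\<close> is positive.\<close>
  moreover note small[of "pi / n"] small[of "pi / 2 / ((1 - \<tau> + \<delta>) * y)"] small[of "e / (1 + (\<tau> + \<delta>))"]
  ultimately have "\<forall>\<^sub>F h in at_right 0. F h ((\<tau> + \<delta>) / 2 * h) / h < 0 \<and> 
     (sin ((1 - \<tau> + \<delta>) * h * y) / y - (1 - \<tau>) * k h) / h > 0 \<and> h > 0 \<and> h < pi / n \<and> h < pi / 2 / ((1 - \<tau> + \<delta>) * y)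
     \<and> h < e / (1 + (\<tau> + \<delta>))"
    using assms e(1) by (auto simp: eventually_conj_iff)
  then show ?thesis
  proof eventually_elim
    case (elim h)
    then have h: "h > 0" "h < pi / n" "h < pi / 2 / ((1 - \<tau> + \<delta>) * y)" "h < e / (1 + (\<tau> + \<delta>))"
      "F h ((\<tau> + \<delta>) / 2 * h) < 0" "sin ((1 - \<tau> + \<delta>) * h * y) / y - (1 - \<tau>) * k h > 0"
      by (auto simp: divide_less_0_iff zero_less_divide_iff)
    have k: "k h \<ge> 0" using h \<open>n > 0\<close> unfolding k_def by (intro divide_nonneg_pos sin_ge_zero) (auto simp: field_simps)
    \<comment> \<open>At \<open>a = 0\<close> the coefficient of \<open>X\<close> is
      \<open>k h * \<tau>\<close>. With the negative value at the right end, the intermediate value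
      theorem gives a zero in between.\<close>
    have "F h 0 \<ge> 0" using k assms(4) by (simp add: F_def s_def c_def)
    moreover have "continuous_on {0..(\<tau> + \<delta>) / 2 * h} (F h)"
      unfolding F_def s_def c_def using \<open>x > 0\<close> by (intro continuous_intros) auto
    ultimately obtain a where a: "0 \<le> a" "a \<le> (\<tau> + \<delta>) / 2 * h" "F h a = 0"
      using IVT2'[of "F h" "(\<tau> + \<delta>) / 2 * h" 0 0] h assms(4,6) by auto
    have "continuous_on {0..(1 - \<tau> + \<delta>) * h} (\<lambda>b. sin (b * y) / y)"
      using \<open>y > 0\<close> by (intro continuous_intros) auto
    then obtain b where b: "0 \<le> b" "b \<le> (1 - \<tau> + \<delta>) * h" "sin (b * y) / y = (1 - \<tau>) * k h"
      using IVT'[of "\<lambda>b. sin (b * y) / y" 0 "(1 - \<tau>) * k h" "(1 - \<tau> + \<delta>) * h"] h k assms(5,6) by auto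
    have "b * y \<le> (1 - \<tau> + \<delta>) * h * y" using b \<open>y > 0\<close> by (intro mult_right_mono) auto
    also have "\<dots> < pi / 2" using h(3) assms by (simp add: pos_less_divide_eq mult.commute mult.left_commute)
    finally have "cos (b * y) > 0" using b(1) \<open>y > 0\<close> by (intro cos_gt_zero_pi) (auto intro: less_le_trans[of _ 0])
    moreover have "W h a > 0"
    proof (rule e(2))
      have "dist (h, a) (0, 0) \<le> \<bar>h\<bar> + \<bar>a\<bar>" by (simp add: dist_prod_def sqrt_sum_squares_le_sum_abs)
      also have "\<dots> \<le> (1 + (\<tau> + \<delta>)) * h" using a h(1) assms(4,6) by (simp add: algebra_simps)
      also have "\<dots> < e" using h(4) assms(4,6) by (simp add: field_simps)
      finally show "dist (h, a) (0, 0) < e" .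
    qed
    ultimately show ?case using a b unfolding F_def W_def by (intro exI[of _ a] exI[of _ b]) auto
  qed
qed


section \<open>Exact factorization of a short exponential\<close>

text \<open>Here \<open>E\<close> stands for the exponential of \<open>- a *\<^sub>R X\<close>, and
  \<open>w\<close>, \<open>k\<close> for the coefficients of that of \<open>h *\<^sub>R C\<close>.
  With equal outer factors, \<open>X ** Y\<close> occurs only in the sum
  \<open>X ** Y + Y ** X\<close>, a scalar, and in \<open>X ** Y ** X\<close>, which lies in the
  span of \<open>X\<close> and \<open>Y\<close>.\<close>

lemma sandwich_expansion:
  fixes X Y :: "complex^'n^'n" and c s w k \<tau> x m :: real
  assumes X: "X ** X = - (x\<^sup>2) *\<^sub>R mat 1" and YX: "Y ** X = (- 2 * m) *\<^sub>R mat 1 - X ** Y"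
    and cs: "c\<^sup>2 + x\<^sup>2 * s\<^sup>2 = 1"
  defines "E \<equiv> c *\<^sub>R mat 1 - s *\<^sub>R X"
  shows "E ** (w *\<^sub>R mat 1 + k *\<^sub>R (\<tau> *\<^sub>R X + (1 - \<tau>) *\<^sub>R Y)) ** E =
    (w * (c\<^sup>2 - x\<^sup>2 * s\<^sup>2) + 2 * k * \<tau> * x\<^sup>2 * c * s + 2 * m * k * (1 - \<tau>) * c * s) *\<^sub>R mat 1
    + (k * \<tau> * (c\<^sup>2 - x\<^sup>2 * s\<^sup>2) - 2 * w * c * s - 2 * k * (1 - \<tau>) * m * s\<^sup>2) *\<^sub>R X
    + ((1 - \<tau>) * k) *\<^sub>R Y"
proof -
  \<comment> \<open>As rewrite rules these bring every product into the span of
    \<open>mat 1\<close>, \<open>X\<close>, \<open>Y\<close> and \<open>X ** Y\<close>. Subtraction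
    is written as a negative multiple so that the distributive laws for sums suffice.\<close>
  have XX': "X ** (X ** A) = - (x\<^sup>2) *\<^sub>R A" for A :: "complex^'n^'n"
    by (simp only: matrix_mul_assoc X scaleR_matrix_mult matrix_mul_lid)
  have YX': "Y ** X = (- 2 * m) *\<^sub>R mat 1 + (- 1) *\<^sub>R (X ** Y)" using YX by simp
  have E: "E = c *\<^sub>R mat 1 + (- s) *\<^sub>R X" by (simp add: E_def)
  \<comment> \<open>The factor of \<open>Y\<close> keeps
    \<open>c\<^sup>2 + x\<^sup>2 * s\<^sup>2\<close> for now: in this form the identity is
    polynomial and does not use \<open>cs\<close>.\<close>
  have "E ** (w *\<^sub>R mat 1 + k *\<^sub>R (\<tau> *\<^sub>R X + (1 - \<tau>) *\<^sub>R Y)) ** E =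
    (w * (c\<^sup>2 - x\<^sup>2 * s\<^sup>2) + 2 * k * \<tau> * x\<^sup>2 * c * s + 2 * m * k * (1 - \<tau>) * c * s) *\<^sub>R mat 1
    + (k * \<tau> * (c\<^sup>2 - x\<^sup>2 * s\<^sup>2) - 2 * w * c * s - 2 * k * (1 - \<tau>) * m * s\<^sup>2) *\<^sub>R X
    + ((1 - \<tau>) * k * (c\<^sup>2 + x\<^sup>2 * s\<^sup>2)) *\<^sub>R Y"
    unfolding E
    by (simp only: matrix_mul_assoc[symmetric] matrix_add_ldistrib matrix_add_rdistrib
        scaleR_matrix_mult matrix_mul_lid matrix_mul_rid X XX' YX' scaleR_right_distrib scaleR_scaleR)
       (simp add: vec_eq_iff scaleR_conv_of_real algebra_simps power2_eq_square)
  then show ?thesis by (simp add: cs)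
qed

text \<open>The factorization is exact; only its duration carries an error, at most
  \<open>2 * \<delta> * h\<close>.\<close>

lemma su2_exp_sandwich:
  fixes X Y :: "complex^2^2"
  assumes X: "X \<in> su2" "X \<noteq> 0" and Y: "Y \<in> su2" "Y \<noteq> 0" and \<tau>: "0 \<le> \<tau>" "\<tau> \<le> 1" and "\<delta> > 0"
  defines "C \<equiv> \<tau> *\<^sub>R X + (1 - \<tau>) *\<^sub>R Y"
  assumes "C \<noteq> 0"
  shows "\<forall>\<^sub>F h in at_right 0. \<exists>a b. 0 \<le> a \<and> 2 * a \<le> (\<tau> + \<delta>) * h \<and> 0 \<le> b \<and> b \<le> (1 - \<tau> + \<delta>) * h \<and>
    matrix_exp (a *\<^sub>R X) ** (matrix_exp (b *\<^sub>R Y) ** matrix_exp (a *\<^sub>R X)) = matrix_exp (h *\<^sub>R C)"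
proof -
  have C: "C \<in> su2" unfolding C_def using X Y by (intro su2_combination)
  obtain x where x: "x > 0" "X ** X = - (x\<^sup>2) *\<^sub>R mat 1"
    "\<And>t. matrix_exp (t *\<^sub>R X) = cos (t * x) *\<^sub>R mat 1 + (sin (t * x) / x) *\<^sub>R X"
    using su2_exp[OF X] by metis
  obtain y where y: "y > 0"
    "\<And>t. matrix_exp (t *\<^sub>R Y) = cos (t * y) *\<^sub>R mat 1 + (sin (t * y) / y) *\<^sub>R Y"
    using su2_exp[OF Y] by metis
  obtain n where n: "n > 0"
    "\<And>t. matrix_exp (t *\<^sub>R C) = cos (t * n) *\<^sub>R mat 1 + (sin (t * n) / n) *\<^sub>R C"
    using su2_exp[OF C \<open>C \<noteq> 0\<close>] by metis
  obtain m where m: "Y ** X = (- 2 * m) *\<^sub>R mat 1 - X ** Y"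
    using su2_anticommutator[OF X(1) Y(1)] by metis
  show ?thesis
    using small_angles[OF x(1) y(1) n(1) \<tau> \<open>\<delta> > 0\<close>, of m]
  proof eventually_elim
    case (elim h)
    then obtain a b where ab: "0 \<le> a" "2 * a \<le> (\<tau> + \<delta>) * h" "0 \<le> b" "b \<le> (1 - \<tau> + \<delta>) * h"
      and F: "sin (h * n) / n * \<tau> * ((cos (a * x))\<^sup>2 - x\<^sup>2 * (sin (a * x) / x)\<^sup>2)
        - 2 * cos (h * n) * cos (a * x) * (sin (a * x) / x)
        - 2 * (sin (h * n) / n) * (1 - \<tau>) * m * (sin (a * x) / x)\<^sup>2 = 0"
      and b: "sin (b * y) / y = (1 - \<tau>) * (sin (h * n) / n)" "cos (b * y) > 0"
      and W: "cos (h * n) * ((cos (a * x))\<^sup>2 - x\<^sup>2 * (sin (a * x) / x)\<^sup>2)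
        + 2 * (sin (h * n) / n) * \<tau> * x\<^sup>2 * cos (a * x) * (sin (a * x) / x)
        + 2 * m * (sin (h * n) / n) * (1 - \<tau>) * cos (a * x) * (sin (a * x) / x) > 0" (is "?W > 0")
      by blast
    \<comment> \<open>\<open>?E\<close> is the inverse of each outer factor, so it remains to show
      that multiplying the exponential of \<open>h *\<^sub>R C\<close> by it on both sides leaves
      that of \<open>b *\<^sub>R Y\<close>.\<close>
    let ?E = "matrix_exp ((- a) *\<^sub>R X)"
    have "(cos (a * x))\<^sup>2 + x\<^sup>2 * (sin (a * x) / x)\<^sup>2 = 1" using x(1) by (simp add: power_divide)
    moreover have E: "?E = cos (a * x) *\<^sub>R mat 1 - (sin (a * x) / x) *\<^sub>R X"
      using x(3)[of "- a"] by simp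
    ultimately have EqE: "?E ** matrix_exp (h *\<^sub>R C) ** ?E = ?W *\<^sub>R mat 1 + (sin (b * y) / y) *\<^sub>R Y"
      using sandwich_expansion[OF x(2) m, of "cos (a * x)" "sin (a * x) / x" "cos (h * n)" "sin (h * n) / n" \<tau>]
      unfolding F b E n(2) by (simp add: C_def)
    \<comment> \<open>Both matrices have determinant 1 and the same coefficient of \<open>Y\<close>,
      so their scalar parts have equal squares; both are positive, hence equal.\<close>
    have "?W = cos (b * y)"
    proof -
      have "det (?W *\<^sub>R mat 1 + (sin (b * y) / y) *\<^sub>R Y) = det (matrix_exp (b *\<^sub>R Y))"
        unfolding EqE[symmetric] by (simp add: det_mul det_su2_matrix_exp X C Y del: scaleR_minus_left)
      then have "?W\<^sup>2 = (cos (b * y))\<^sup>2"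
        unfolding y(2) det_scaleR_mat_1_plus[OF Y(1)] of_real_eq_iff by simp
      then show ?thesis using W b(2) by (simp only: power2_eq_iff_nonneg less_imp_le)
    qed
    with EqE have *: "?E ** matrix_exp (h *\<^sub>R C) ** ?E = matrix_exp (b *\<^sub>R Y)" by (simp add: y(2))
    have "matrix_exp (a *\<^sub>R X) ** (matrix_exp (b *\<^sub>R Y) ** matrix_exp (a *\<^sub>R X)) =
      (matrix_exp (a *\<^sub>R X) ** ?E) ** matrix_exp (h *\<^sub>R C) ** (?E ** matrix_exp (a *\<^sub>R X))"
      unfolding *[symmetric] by (simp only: matrix_mul_assoc)
    also have "\<dots> = matrix_exp (h *\<^sub>R C)"
      by (simp only: su2_exp_add[OF X(1)]) (simp add: matrix_exp_0)
    finally show ?case using ab by blast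
  qed
qed

section \<open>Replacing relaxed controls by products of the two given ones\<close>

lemma control_product_append: "control_product (as @ bs) = control_product as ** control_product bs"
  by (induction as) (auto simp: control_product_def matrix_mul_assoc)

lemma control_product_replicate:
  "control_product (concat (replicate N cs)) = ((**) (control_product cs) ^^ N) (mat 1)"
  by (induction N) (simp_all add: control_product_append, simp add: control_product_def)

lemma sum_list_fst_replicate:
  "sum_list (map fst (concat (replicate N cs))) = real N * sum_list (map fst cs)"
  for cs :: "(real \<times> 'a) list"
  by (induction N) (simp_all add: algebra_simps)

definition admissible :: "(complex^'n^'n) set \<Rightarrow> (real \<times> (complex^'n^'n)) list \<Rightarrow> bool" where
  "admissible S cs \<longleftrightarrow> (\<forall>(t, A) \<in> set cs. 0 \<le> t \<and> A \<in> S)"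

text \<open>Cut the segment into equal pieces short enough for \<open>su2_exp_sandwich\<close> and
  repeat one sandwich; the relative excess of time is the same for every piece.\<close>

lemma segment_approx:
  fixes X Y :: "complex^2^2"
  assumes X: "X \<in> su2" and Y: "Y \<in> su2" and \<tau>: "0 \<le> \<tau>" "\<tau> \<le> 1" and "0 \<le> t" "\<epsilon> > 0"
  defines "C \<equiv> \<tau> *\<^sub>R X + (1 - \<tau>) *\<^sub>R Y"
  shows "\<exists>ds. admissible {X, Y} ds \<and> control_product ds = matrix_exp (t *\<^sub>R C) \<and> sum_list (map fst ds) \<le> t + \<epsilon>"
proof -
  \<comment> \<open>The sandwich needs \<open>X\<close>, \<open>Y\<close> and \<open>C\<close>
    nonzero. If \<open>X\<close> or \<open>Y\<close> vanishes, \<open>C\<close> is a multiple of the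
    other by a factor at most 1, and one exponential with shortened time is enough.\<close>
  consider "t *\<^sub>R C = 0" | "X = 0" | "Y = 0" | "t > 0" "X \<noteq> 0" "Y \<noteq> 0" "C \<noteq> 0"
    using \<open>0 \<le> t\<close> by force
  then show ?thesis
  proof cases
    case 1
    show ?thesis unfolding 1 using assms(5,6)
      by (intro exI[of _ "[]"]) (simp add: admissible_def control_product_def matrix_exp_0)
  next
    case 2
    then show ?thesis using assms(3-6) mult_left_le[of "1 - \<tau>" t]
      by (intro exI[of _ "[(t * (1 - \<tau>), Y)]"]) (simp add: admissible_def control_product_def C_def)
  next
    case 3
    then show ?thesis using assms(3-6) mult_left_le[of \<tau> t]
      by (intro exI[of _ "[(t * \<tau>, X)]"]) (simp add: admissible_def control_product_def C_def)
  next
    case 4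
    have C: "C \<in> su2" unfolding C_def using X Y by (intro su2_combination)
    \<comment> \<open>Each piece of length \<open>h\<close> will cost at most
      \<open>(1 + 2 * \<delta>) * h\<close>, so this choice makes the total
      \<open>t + \<epsilon>\<close>.\<close>
    define \<delta> where "\<delta> = \<epsilon> / (2 * t)"
    have "\<delta> > 0" using 4 \<open>\<epsilon> > 0\<close> by (simp add: \<delta>_def)
    note ev = su2_exp_sandwich[OF X 4(2) Y 4(3) \<tau> this 4(4)[unfolded C_def], folded C_def]
    \<comment> \<open>Turns "for all small positive \<open>h\<close>" into a number of pieces;
      \<open>Suc N\<close> keeps the divisor positive.\<close>
    have "filterlim (\<lambda>N. t / real (Suc N)) (at_right 0) sequentially"
      using \<open>t > 0\<close> by (auto simp: filterlim_at eventually_sequentially simp del: of_nat_Suc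
        intro!: tendsto_divide_0[OF tendsto_const] filterlim_compose[OF filterlim_real_sequentially filterlim_Suc]
          filterlim_at_top_imp_at_infinity)
    from eventually_happens'[OF _ filterlim_iff[THEN iffD1, rule_format, OF this ev]]
    obtain N a b where ab: "0 \<le> a" "2 * a \<le> (\<tau> + \<delta>) * (t / real (Suc N))" "0 \<le> b" "b \<le> (1 - \<tau> + \<delta>) * (t / real (Suc N))"
      "matrix_exp (a *\<^sub>R X) ** (matrix_exp (b *\<^sub>R Y) ** matrix_exp (a *\<^sub>R X)) = matrix_exp ((t / real (Suc N)) *\<^sub>R C)"
      by auto
    let ?cs = "[(a, X), (b, Y), (a, X)]" and ?N = "Suc N"
    have "control_product (concat (replicate ?N ?cs)) = matrix_exp (t *\<^sub>R C)"
      unfolding control_product_replicate using ab(5) su2_exp_power[OF C, of ?N "t / real ?N"]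
      by (simp add: control_product_def del: funpow.simps of_nat_Suc)
    moreover have "admissible {X, Y} (concat (replicate ?N ?cs))"
      using ab by (auto simp: admissible_def)
    moreover have "sum_list (map fst (concat (replicate ?N ?cs))) \<le> t + \<epsilon>"
    proof -
      have "(\<tau> + \<delta>) * h + (1 - \<tau> + \<delta>) * h = (1 + 2 * \<delta>) * h" for h
        by (simp add: algebra_simps)
      from this[of "t / real ?N"] ab(2,4)
      have "a + (b + a) \<le> (1 + 2 * \<delta>) * (t / real ?N)" by linarith
      then have "real ?N * (a + (b + a)) \<le> real ?N * ((1 + 2 * \<delta>) * (t / real ?N))"
        by (rule mult_left_mono) simp
      also have "\<dots> = (1 + 2 * \<delta>) * t" by (simp del: of_nat_Suc)
      also have "\<dots> = t + \<epsilon>" using \<open>t > 0\<close> by (simp add: \<delta>_def field_simps)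
      finally show ?thesis unfolding sum_list_fst_replicate by simp
    qed
    ultimately show ?thesis by blast
  qed
qed

text \<open>Replace the controls one by one, spending half of the remaining allowance \<epsilon> on
  the first and leaving the other half for the rest.\<close>

lemma relaxed_approx:
  fixes X Y :: "complex^2^2"
  assumes X: "X \<in> su2" and Y: "Y \<in> su2"
    and "admissible {\<tau> *\<^sub>R X + (1 - \<tau>) *\<^sub>R Y | \<tau>. \<tau> \<in> {0..1}} cs" and "\<epsilon> > 0"
  shows "\<exists>ds. admissible {X, Y} ds \<and> control_product ds = control_product cs \<and>
    sum_list (map fst ds) \<le> sum_list (map fst cs) + \<epsilon>"
  using assms(3,4)
proof (induction cs arbitrary: \<epsilon>)
  case Nil
  then show ?case by (intro exI[of _ "[]"]) (simp add: admissible_def)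
next
  case (Cons c cs)
  obtain t \<tau> where c: "c = (t, \<tau> *\<^sub>R X + (1 - \<tau>) *\<^sub>R Y)" "0 \<le> \<tau>" "\<tau> \<le> 1" "0 \<le> t"
    using Cons.prems(1) by (auto simp: admissible_def)
  have "admissible {\<tau> *\<^sub>R X + (1 - \<tau>) *\<^sub>R Y | \<tau>. \<tau> \<in> {0..1}} cs" "\<epsilon> / 2 > 0"
    using Cons.prems by (auto simp: admissible_def)
  from Cons.IH[OF this] obtain ds where ds: "admissible {X, Y} ds" "control_product ds = control_product cs"
    "sum_list (map fst ds) \<le> sum_list (map fst cs) + \<epsilon> / 2"
    by blast
  obtain es where es: "admissible {X, Y} es" 
    "control_product es = matrix_exp (t *\<^sub>R (\<tau> *\<^sub>R X + (1 - \<tau>) *\<^sub>R Y))" "sum_list (map fst es) \<le> t + \<epsilon> / 2"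
    using segment_approx[OF X Y c(2-4), of "\<epsilon> / 2"] Cons.prems(2) by auto
  show ?case
  proof (intro exI conjI)
    show "admissible {X, Y} (es @ ds)" using ds es by (auto simp: admissible_def)
    show "control_product (es @ ds) = control_product (c # cs)"
      using ds(2) es(2) by (simp add: control_product_append c(1)) (simp add: control_product_def)
    show "sum_list (map fst (es @ ds)) \<le> sum_list (map fst (c # cs)) + \<epsilon>"
      using ds(3) es(3) by (simp add: c(1))
  qed
qed

section \<open>Comparison of the two infima\<close>

lemma optimal_time_le:
  assumes "admissible S cs"
  shows "optimal_time S (control_product cs) \<le> sum_list (map fst cs)"
  using assms unfolding optimal_time_def admissible_def by (intro Inf_lower) auto

lemma optimal_time_greatest:
  assumes "\<And>cs. admissible S cs \<Longrightarrow> g = control_product cs \<Longrightarrow> z \<le> sum_list (map fst cs)"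
  shows "z \<le> optimal_time S g"
  using assms unfolding optimal_time_def admissible_def by (intro Inf_greatest) auto

theorem theorem1p4:
  fixes X Y g :: "complex^2^2"
  assumes "X \<in> su2" and "Y \<in> su2" and "g \<in> SU2"
  shows "optimal_time {X, Y} g =
         optimal_time {\<tau> *\<^sub>R X + (1 - \<tau>) *\<^sub>R Y | \<tau>. \<tau> \<in> {0..1}} g"
    (is "_ = optimal_time ?C g")
proof (rule antisym)
  show "optimal_time {X, Y} g \<le> optimal_time ?C g"
  proof (rule optimal_time_greatest)
    fix cs assume cs: "admissible ?C cs" "g = control_product cs"
    show "optimal_time {X, Y} g \<le> sum_list (map fst cs)"
    \<comment> \<open>The replacement costs an arbitrarily small positive extra time, so the bound
      is proved up to every positive \<epsilon>.\<close>
    proof (rule ereal_le_epsilon2)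
      fix \<epsilon> :: real assume "0 < \<epsilon>"
      then obtain ds where "admissible {X, Y} ds" "control_product ds = g"
        "sum_list (map fst ds) \<le> sum_list (map fst cs) + \<epsilon>"
        using relaxed_approx[OF assms(1,2) cs(1)] cs(2) by metis
      then show "optimal_time {X, Y} g \<le> sum_list (map fst cs) + ereal \<epsilon>"
        using optimal_time_le[of "{X, Y}" ds] by (auto intro: order_trans)
    qed
  qed
  \<comment> \<open>\<open>X\<close> and \<open>Y\<close> are the endpoints \<tau> = 1 and \<tau> =
    0, so the larger set has the smaller infimum.\<close>
  have "X \<in> ?C" by (intro CollectI exI[of _ 1]) simp
  moreover have "Y \<in> ?C" by (intro CollectI exI[of _ 0]) simp
  ultimately have "{X, Y} \<subseteq> ?C" by simp
  then show "optimal_time ?C g \<le> optimal_time {X, Y} g"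
    by (intro optimal_time_greatest) (force simp: admissible_def intro!: optimal_time_le)
qed

end
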